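(* Let $M$ be a unital $C^*$-algebra, and let $A,B$ be $C^*$-subalgebras of $M$ containing the unit of $M$. Let $\Phi_B:M\to B$ be a conditional expectation, and let $\tau$ be a tracial state on $B$. If there is a sequence of unitaries $w_n\in\mathcal{U}(A)$ such that $$\|\Phi_B(xw_ny)\|_2\underset{n\to\infty}{\longrightarrow}0\qquad\text{for all }x,y\in M,$$ then there is no unitary $v\in\mathcal{U}(M)$ such that $vAv^*\subseteq B$.
   Context: $\mathcal{U}(\cdot)$ denotes the unitary group. For $b\in B$, $\|b\|_2=\tau(b^*b)^{1/2}$. *)

theory Defs
  imports "HOL-Analysis.Analysis"
begin

text \<open>
  Unital $C^*$-algebras as a type class. The superclass \<^class>\<open>real_normed_algebra_1\<close> supplies the
  unit, submultiplicativity of the norm and \<open>norm 1 = 1\<close>, which excludes only the zero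
  algebra, which has no unital subalgebra carrying a state.
\<close>

class unital_cstar_algebra = real_normed_algebra_1 + banach +
  fixes scaleC :: "complex \<Rightarrow> 'a \<Rightarrow> 'a"
    and adj :: "'a \<Rightarrow> 'a"
  assumes scaleC_of_real: "scaleC (complex_of_real r) x = scaleR r x"
    and scaleC_add_right: "scaleC c (x + y) = scaleC c x + scaleC c y"
    and scaleC_add_left: "scaleC (c + d) x = scaleC c x + scaleC d x"
    and scaleC_scaleC: "scaleC c (scaleC d x) = scaleC (c * d) x"
    and mult_scaleC_left: "scaleC c x * y = scaleC c (x * y)"
    and mult_scaleC_right: "x * scaleC c y = scaleC c (x * y)"
    and norm_scaleC: "norm (scaleC c x) = cmod c * norm x"
    and adj_adj: "adj (adj x) = x"
    and adj_add: "adj (x + y) = adj x + adj y"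
    and adj_scaleC: "adj (scaleC c x) = scaleC (cnj c) (adj x)"
    and adj_mult: "adj (x * y) = adj y * adj x"
    and cstar_identity: "norm (adj x * x) = (norm x)\<^sup>2"

definition cstar_subalgebra :: "'a::unital_cstar_algebra set \<Rightarrow> bool" where
  "cstar_subalgebra S \<longleftrightarrow>
     0 \<in> S \<and>
     (\<forall>x\<in>S. \<forall>y\<in>S. x + y \<in> S) \<and>
     (\<forall>c. \<forall>x\<in>S. scaleC c x \<in> S) \<and>
     (\<forall>x\<in>S. \<forall>y\<in>S. x * y \<in> S) \<and>
     (\<forall>x\<in>S. adj x \<in> S) \<and>
     closed S"

text \<open>The unitary group of a subalgebra containing the unit of the ambient algebra.\<close>

definition unitaries :: "'a::unital_cstar_algebra set \<Rightarrow> 'a set" where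
  "unitaries S = {u \<in> S. adj u * u = 1 \<and> u * adj u = 1}"

definition positive_element :: "'a::unital_cstar_algebra \<Rightarrow> bool" where
  "positive_element a \<longleftrightarrow> (\<exists>x. a = adj x * x)"

text \<open>
  A conditional expectation is a positive complex-linear projection onto \<open>B\<close> that is a
  \<open>B\<close>-bimodule map. Contractivity and complete positivity, often listed as well, follow from these
  conditions and are not assumed. Positivity in \<open>B\<close> and in the ambient algebra coincide for a
  $C^*$-subalgebra \<open>B\<close>.
\<close>

definition conditional_expectation ::
    "'a::unital_cstar_algebra set \<Rightarrow> ('a \<Rightarrow> 'a) \<Rightarrow> bool" where
  "conditional_expectation B \<Phi> \<longleftrightarrow>
     (\<forall>x. \<Phi> x \<in> B) \<and>
     (\<forall>x y. \<Phi> (x + y) = \<Phi> x + \<Phi> y) \<and>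
     (\<forall>c x. \<Phi> (scaleC c x) = scaleC c (\<Phi> x)) \<and>
     (\<forall>b\<in>B. \<Phi> b = b) \<and>
     (\<forall>x. positive_element x \<longrightarrow> positive_element (\<Phi> x)) \<and>
     (\<forall>b\<in>B. \<forall>c\<in>B. \<forall>x. \<Phi> (b * x * c) = b * \<Phi> x * c)"

text \<open>
  A functional on \<open>B\<close> is a function on the whole type of which only the values on \<open>B\<close> matter.
  For a positive functional on a unital $C^*$-algebra, norm one means value \<open>1\<close> at the unit.
\<close>

definition tracial_state_on ::
    "'a::unital_cstar_algebra set \<Rightarrow> ('a \<Rightarrow> complex) \<Rightarrow> bool" where
  "tracial_state_on B \<tau> \<longleftrightarrow>
     (\<forall>x\<in>B. \<forall>y\<in>B. \<tau> (x + y) = \<tau> x + \<tau> y) \<and>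
     (\<forall>c. \<forall>x\<in>B. \<tau> (scaleC c x) = c * \<tau> x) \<and>
     (\<forall>x\<in>B. \<tau> (adj x * x) \<in> \<real>\<^sub>\<ge>\<^sub>0) \<and>
     \<tau> 1 = 1 \<and>
     (\<forall>x\<in>B. \<forall>y\<in>B. \<tau> (x * y) = \<tau> (y * x))"

text \<open>
  For \<open>b \<in> B\<close> and a state \<open>\<tau>\<close> on \<open>B\<close>, the value \<open>\<tau> (adj b * b)\<close> is a nonnegative real,
  so taking the real part only changes its type.
\<close>

definition norm2 :: "('a::unital_cstar_algebra \<Rightarrow> complex) \<Rightarrow> 'a \<Rightarrow> real" where
  "norm2 \<tau> b = sqrt (Re (\<tau> (adj b * b)))"

end

theory Submission
  imports Defs
begin

text \<open>Conjugation by a unitary \<open>v\<close> sends unitaries of \<open>A\<close> to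
  unitaries, so if it also sends \<open>A\<close> into \<open>B\<close>, each
  \<open>v * w n * adj v\<close> is a unitary lying in \<open>B\<close>. The conditional expectation
  fixes it, and a unitary has 2-norm \<open>sqrt 1 = 1\<close> because the state takes the value 1
  at the unit. Along this one pair of multipliers the 2-norms therefore stay at 1 and cannot tend to
  0.\<close>

theorem lemma2p3:
  fixes A B :: "'a::unital_cstar_algebra set"
    and \<Phi>\<^sub>B :: "'a \<Rightarrow> 'a"
    and \<tau> :: "'a \<Rightarrow> complex"
  assumes "cstar_subalgebra A" and "1 \<in> A"
    and "cstar_subalgebra B" and "1 \<in> B"
    and "conditional_expectation B \<Phi>\<^sub>B"
    and "tracial_state_on B \<tau>"
    and "\<exists>w :: nat \<Rightarrow> 'a. (\<forall>n. w n \<in> unitaries A) \<and>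
           (\<forall>x y. (\<lambda>n. norm2 \<tau> (\<Phi>\<^sub>B (x * w n * y))) \<longlonglongrightarrow> 0)"
  shows "\<not> (\<exists>v \<in> unitaries UNIV. (\<lambda>a. v * a * adj v) ` A \<subseteq> B)"
proof
  assume "\<exists>v \<in> unitaries UNIV. (\<lambda>a. v * a * adj v) ` A \<subseteq> B"
  then obtain v where v: "adj v * v = 1" "v * adj v = 1"
    and vAB: "\<And>a. a \<in> A \<Longrightarrow> v * a * adj v \<in> B"
    by (auto simp: unitaries_def)
  obtain w :: "nat \<Rightarrow> 'a" where w: "\<And>n. w n \<in> unitaries A"
    and lim: "\<And>x y. (\<lambda>n. norm2 \<tau> (\<Phi>\<^sub>B (x * w n * y))) \<longlonglongrightarrow> 0"
    using assms(7) by blast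
  have "norm2 \<tau> (\<Phi>\<^sub>B (v * w n * adj v)) = 1" for n
  proof -
    have "w n \<in> A" and wn: "adj (w n) * w n = 1"
      using w[of n] by (auto simp: unitaries_def)
    then have "\<Phi>\<^sub>B (v * w n * adj v) = v * w n * adj v"
      using vAB assms(5) by (simp add: conditional_expectation_def)
    \<comment> \<open>The bracketing brings \<open>adj v * v\<close> together, so the product
      collapses from the inside out: first this factor, then \<open>adj (w n) * w n\<close>, and
      finally \<open>v * adj v\<close>.\<close>
    moreover have "adj (v * w n * adj v) * (v * w n * adj v)
        = v * (adj (w n) * ((adj v * v) * (w n * adj v)))"
      by (simp only: adj_mult adj_adj mult.assoc)
    then have "adj (v * w n * adj v) * (v * w n * adj v) = v * ((adj (w n) * w n) * adj v)"
      by (simp only: v mult_1_left mult.assoc)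
    then have "adj (v * w n * adj v) * (v * w n * adj v) = 1"
      by (simp only: v wn mult_1_left)
    moreover have "\<tau> 1 = 1"
      using assms(6) by (simp add: tracial_state_on_def)
    ultimately show ?thesis
      by (simp add: norm2_def)
  qed
  \<comment> \<open>Taking \<open>x = v\<close> and \<open>y = adj v\<close> in the hypothesis makes
    the constant sequence 1 converge to 0.\<close>
  then show False
    using lim[of v "adj v"] by (simp add: LIMSEQ_const_iff)
qed

end
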